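(* Let $X$ be a non-empty set, let $c\geq 0$ be a fixed real constant, and let $F\colon X\times X\to\mathbb{C}$ be a mapping satisfying $$|F(a,x)\cdot F(x,b)-F(a,b)|\leq c\quad\text{for all } a,b,x\in X.$$ Assume that there exist $x_0,y_0\in X$ such that the maps $F(x_0,\cdot)\colon X\to\mathbb{C}$ and $F(\cdot,y_0)\colon X\to\mathbb{C}$ are unbounded. Then there exists a mapping $f\colon X\to\mathbb{C}\setminus\{0\}$ such that $$F(u,v)=\frac{f(u)}{f(v)}\quad\text{for all } u,v\in X.$$
   Context: A map $g\colon X\to\mathbb{C}$ is unbounded if $\sup_{x\in X}|g(x)|=\infty$. Here $F(x_0,\cdot)$ denotes the map $y\mapsto F(x_0,y)$ and $F(\cdot,y_0)$ denotes the map $x\mapsto F(x,y_0)$. No structure on $X$ is assumed. *)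

theory Defs
  imports "HOL-Analysis.Analysis"
begin

(* The supremum is taken in the extended reals, so that it exists for every g. *)
definition unbounded_on :: "'a set \<Rightarrow> ('a \<Rightarrow> complex) \<Rightarrow> bool" where
  "unbounded_on X g \<longleftrightarrow> (SUP x\<in>X. ereal (cmod (g x))) = \<infinity>"

lemma unbounded_on_iff_not_bounded:
  "unbounded_on X g \<longleftrightarrow> \<not> bounded (g ` X)"
proof
  assume unb: "unbounded_on X g"
  show "\<not> bounded (g ` X)"
  proof
    assume "bounded (g ` X)"
    then obtain B where B: "\<And>x. x \<in> X \<Longrightarrow> cmod (g x) \<le> B"
      by (auto simp: bounded_iff)
    have "(SUP x\<in>X. ereal (cmod (g x))) \<le> ereal B"
      by (rule SUP_least) (simp add: B)
    with unb show False
      by (simp add: unbounded_on_def)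
  qed
next
  assume nb: "\<not> bounded (g ` X)"
  have "\<exists>x\<in>X. ereal (real n) \<le> ereal (cmod (g x))" for n :: nat
    using nb unfolding bounded_iff by (force simp: not_le intro: less_imp_le)
  then show "unbounded_on X g"
    unfolding unbounded_on_def by (intro SUP_PInfty) auto
qed

end

theory Submission
  imports Defs
begin

text \<open>
  The condition says that \<open>F\<close> satisfies the multiplicative Sincov equation
  \<open>F a x * F x b = F a b\<close> up to a bounded error. The equation is superstable: an unbounded map
  forces the error to vanish. Expanding the triple product \<open>F a x * F x y * F y b\<close> in its
  two ways of association shows that \<open>(F a x * F x y - F a y) * F y b\<close> is bounded by
  \<open>2 * c + c * cmod (F a x)\<close>, a quantity free of \<open>b\<close>. Hence the first factor is zero as soon as
  \<open>F y b\<close> takes arbitrarily large values in \<open>b\<close> (\<open>sincov_exact_if_row_unbounded\<close>), and one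
  unbounded row makes all rows unbounded (\<open>unbounded_row_propagates\<close>), so the equation is exact.

  An exact solution with a nonzero value has \<open>F x0 x0 = 1\<close> and \<open>F x0 x * F x x0 = 1\<close>, so the
  column \<open>f = (\<lambda>u. F u x0)\<close> vanishes nowhere and \<open>F u v * f v = f u\<close>
  (\<open>exact_sincov_is_quotient\<close>).
\<close>

lemma unbounded_on_exceeds:
  assumes "unbounded_on X g"
  obtains x where "x \<in> X" "cmod (g x) > B"
proof -
  have "\<not> bounded (g ` X)"
    using assms by (simp add: unbounded_on_iff_not_bounded)
  then show thesis
    using that unfolding bounded_iff by (metis (no_types, lifting) imageE not_le)
qed

text \<open>
  The row at \<open>a\<close> differs from \<open>F a x\<close> times the row at \<open>x\<close> by at most \<open>c\<close>, so a bound on the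
  row at \<open>x\<close> would bound the row at \<open>a\<close>.
\<close>

lemma unbounded_row_propagates:
  fixes F :: "'a \<Rightarrow> 'a \<Rightarrow> complex"
  assumes near: "\<And>b. b \<in> X \<Longrightarrow> cmod (F a x * F x b - F a b) \<le> c"
    and unb: "unbounded_on X (F a)"
  shows "unbounded_on X (F x)"
  unfolding unbounded_on_iff_not_bounded
proof
  assume "bounded (F x ` X)"
  then obtain B where B: "\<And>b. b \<in> X \<Longrightarrow> cmod (F x b) \<le> B"
    by (auto simp: bounded_iff)
  obtain b where b: "b \<in> X" and large: "cmod (F a b) > cmod (F a x) * B + c"
    using unbounded_on_exceeds[OF unb] .
  have "cmod (F a b) \<le> cmod (F a x * F x b) + cmod (F a x * F x b - F a b)"
    by (metis norm_minus_commute norm_triangle_sub)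
  also have "\<dots> \<le> cmod (F a x) * B + c"
    using near[OF b] B[OF b] by (auto simp: norm_mult intro!: add_mono mult_left_mono)
  finally show False
    using large by simp
qed

lemma sincov_exact_if_row_unbounded:
  fixes F :: "'a \<Rightarrow> 'a \<Rightarrow> complex"
  assumes near: "\<And>a b x. \<lbrakk>a \<in> X; b \<in> X; x \<in> X\<rbrakk> \<Longrightarrow> cmod (F a x * F x b - F a b) \<le> c"
    and X: "a \<in> X" "x \<in> X" "y \<in> X"
    and unb: "unbounded_on X (F y)"
  shows "F a x * F x y = F a y"
proof (rule ccontr)
  let ?d = "F a x * F x y - F a y"
  assume "F a x * F x y \<noteq> F a y"
  then have d: "cmod ?d > 0"
    by simp
  obtain b where b: "b \<in> X" and large: "cmod (F y b) > (2 * c + c * cmod (F a x)) / cmod ?d"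
    using unbounded_on_exceeds[OF unb] .
  \<comment> \<open>Both associations of the triple product are compared with \<open>F a b\<close>, one of them through
    \<open>F a x * F x b\<close>.\<close>
  have "?d * F y b = F a x * (F x y * F y b - F x b) + (F a x * F x b - F a b)
      - (F a y * F y b - F a b)"
    by (simp add: algebra_simps)
  then have "cmod (?d * F y b) \<le> cmod (F a x * (F x y * F y b - F x b))
      + cmod (F a x * F x b - F a b) + cmod (F a y * F y b - F a b)"
    by (metis norm_triangle_ineq norm_triangle_ineq4 add_right_mono order_trans)
  also have "\<dots> \<le> cmod (F a x) * c + c + c"
    unfolding norm_mult by (intro add_mono mult_left_mono near X b norm_ge_zero)
  finally have "cmod (F y b) * cmod ?d \<le> 2 * c + c * cmod (F a x)"
    by (simp add: norm_mult mult.commute)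
  with large d show False
    by (simp add: pos_divide_less_eq)
qed

lemma exact_sincov_is_quotient:
  fixes F :: "'a \<Rightarrow> 'a \<Rightarrow> 'b :: field"
  assumes exact: "\<And>a x b. \<lbrakk>a \<in> X; x \<in> X; b \<in> X\<rbrakk> \<Longrightarrow> F a x * F x b = F a b"
    and z: "z \<in> X" and y: "y \<in> X" and nonzero: "F z y \<noteq> 0"
  shows "\<forall>x\<in>X. F x z \<noteq> 0" and "\<forall>u\<in>X. \<forall>v\<in>X. F u v = F u z / F v z"
proof -
  have "F z z = 1"
    using exact[OF z z y] nonzero by simp
  then show nz: "\<forall>x\<in>X. F x z \<noteq> 0"
    using exact[OF z _ z] by fastforce
  show "\<forall>u\<in>X. \<forall>v\<in>X. F u v = F u z / F v z"
    using exact[OF _ _ z] nz by (simp add: eq_divide_eq)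
qed

theorem theorem1:
  fixes X :: "'a set" and c :: real and F :: "'a \<Rightarrow> 'a \<Rightarrow> complex"
  assumes "X \<noteq> {}"
    and "c \<ge> 0"
    and "\<forall>a\<in>X. \<forall>b\<in>X. \<forall>x\<in>X. cmod (F a x * F x b - F a b) \<le> c"
    and "\<exists>x0\<in>X. \<exists>y0\<in>X. unbounded_on X (\<lambda>y. F x0 y) \<and> unbounded_on X (\<lambda>x. F x y0)"
  shows "\<exists>f :: 'a \<Rightarrow> complex. (\<forall>x\<in>X. f x \<noteq> 0) \<and> (\<forall>u\<in>X. \<forall>v\<in>X. F u v = f u / f v)"
proof -
  have near: "cmod (F a x * F x b - F a b) \<le> c" if "a \<in> X" "b \<in> X" "x \<in> X" for a b x
    using assms(3) that by blast
  obtain x0 where x0: "x0 \<in> X" and unb: "unbounded_on X (F x0)"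
    using assms(4) by auto
  have "unbounded_on X (F y)" if "y \<in> X" for y
    using unbounded_row_propagates[OF near[OF x0 _ that] unb] .
  then have exact: "F a x * F x b = F a b" if "a \<in> X" "x \<in> X" "b \<in> X" for a x b
    using sincov_exact_if_row_unbounded[of X F c, OF near] that by blast
  obtain y where y: "y \<in> X" and "cmod (F x0 y) > 0"
    using unbounded_on_exceeds[OF unb] .
  then have nonzero: "F x0 y \<noteq> 0"
    by simp
  show ?thesis
    using exact_sincov_is_quotient[of X F, OF exact x0 y nonzero]
    by (intro exI[of _ "\<lambda>u. F u x0"]) simp
qed

end
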